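(* Suppose that for every integer $n\geq 1$ we have $\mathrm{LP}(n) = \mathrm{LP}^*(n)$, where $\mathrm{LP}^*(3t) = 2t + \frac{t}{3t+1}$, $\mathrm{LP}^*(3t+1) = 2t+1$ and $\mathrm{LP}^*(3t+2) = 2t+1+\frac{2t+1}{3t+2}$ for integers $t \geq 0$. Then $N(n) = \left\lfloor \frac{2n+1}{3}\right\rfloor$ for every integer $n \geq 1$.
   Context: For a positive integer $n$, the triangle of size $n$ is the set of cells $T_n = \{(a,b) : a,b \in \{1,\dots,n\},\ a+b \geq n+1\}$ of an $n\times n$ grid ($a$ = row index from top, $b$ = column index from left). A row is a set of cells of $T_n$ with fixed $a$, a column is a set with fixed $b$, and a standard diagonal is a set of cells of $T_n$ with fixed $a+b$. $N(n)$ denotes the maximum number of dots that can be placed into cells of $T_n$ (at most one per cell) such that each row, each column and each standard diagonal contains at most one dot. $\mathrm{LP}(n)$ denotes the optimal value of the linear program: maximize $\sum_{C\in T_n} x_C$ over real variables $x_C \geq 0$ ($C \in T_n$) subject to the constraints that the sum of the $x_C$ over the cells $C$ of each row, of each column and of each standard diagonal is at most $1$. *)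

theory Defs
  imports Complex_Main
begin

type_synonym cell = "nat \<times> nat"

text \<open>Cells are pairs (row index from the top, column index from the left), both 1-based.\<close>

definition triangle :: "nat \<Rightarrow> cell set" where
  "triangle n = {(a, b). a \<in> {1..n} \<and> b \<in> {1..n} \<and> a + b \<ge> n + 1}"

definition row :: "nat \<Rightarrow> nat \<Rightarrow> cell set" where
  "row n i = {(a, b) \<in> triangle n. a = i}"

definition column :: "nat \<Rightarrow> nat \<Rightarrow> cell set" where
  "column n j = {(a, b) \<in> triangle n. b = j}"

definition diagonal :: "nat \<Rightarrow> nat \<Rightarrow> cell set" where
  "diagonal n s = {(a, b) \<in> triangle n. a + b = s}"

text \<open>The index ranges are those for which the row, column or diagonal is nonempty.\<close>

definition lines :: "nat \<Rightarrow> cell set set" where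
  "lines n = row n ` {1..n} \<union> column n ` {1..n} \<union> diagonal n ` {n + 1..2 * n}"

definition dot_placement :: "nat \<Rightarrow> cell set \<Rightarrow> bool" where
  "dot_placement n D \<longleftrightarrow> D \<subseteq> triangle n \<and> (\<forall>L\<in>lines n. card (D \<inter> L) \<le> 1)"

definition max_dots :: "nat \<Rightarrow> nat" where
  "max_dots n = Max {card D |D. dot_placement n D}"

definition LP_feasible :: "nat \<Rightarrow> (cell \<Rightarrow> real) \<Rightarrow> bool" where
  "LP_feasible n x \<longleftrightarrow> (\<forall>C\<in>triangle n. x C \<ge> 0) \<and> (\<forall>L\<in>lines n. (\<Sum>C\<in>L. x C) \<le> 1)"

text \<open>
  The values of x outside the triangle are unconstrained, but do not occur in the objective.
  The set of objective values is nonempty and bounded (by n, summing the row constraints), so the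
  supremum is the genuine one.
\<close>

definition LP :: "nat \<Rightarrow> real" where
  "LP n = Sup {\<Sum>C\<in>triangle n. x C |x. LP_feasible n x}"

definition LP_star :: "nat \<Rightarrow> real" where
  "LP_star n =
    (let t = real (n div 3) in
     if n mod 3 = 0 then 2 * t + t / (3 * t + 1)
     else if n mod 3 = 1 then 2 * t + 1
     else 2 * t + 1 + (2 * t + 1) / (3 * t + 2))"

lemma LP_star_simps:
  "LP_star (3 * t) = 2 * real t + real t / (3 * real t + 1)"
  "LP_star (3 * t + 1) = 2 * real t + 1"
  "LP_star (3 * t + 2) = 2 * real t + 1 + (2 * real t + 1) / (3 * real t + 2)"
proof -
  have "(3 * t + 1) mod 3 = 1" "(3 * t + 1) div 3 = t"
       "(3 * t + 2) mod 3 = 2" "(3 * t + 2) div 3 = t"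
    by presburger+
  then show
    "LP_star (3 * t) = 2 * real t + real t / (3 * real t + 1)"
    "LP_star (3 * t + 1) = 2 * real t + 1"
    "LP_star (3 * t + 2) = 2 * real t + 1 + (2 * real t + 1) / (3 * real t + 2)"
    unfolding LP_star_def Let_def by simp_all
qed

end

theory Submission
  imports Defs
begin

text \<open>
  The indicator function of a dot placement is feasible for the linear program, so
  \<open>N(n) \<le> \<lfloor>LP(n)\<rfloor>\<close>, and the floor of \<open>LP*(n)\<close> is \<open>\<lfloor>(2n+1)/3\<rfloor>\<close>.
  Conversely, describe a cell by the barycentric coordinates
  \<open>p = n - a\<close>, \<open>q = n - b\<close>, \<open>r = n - 1 - p - q\<close>. For \<open>n = 3t+1\<close> the triples of nonnegative integers
  \<open>(i, 2t-2i, t+i)\<close> with \<open>i \<le> t\<close> and \<open>(i, 4t+1-2i, i-t-1)\<close> with \<open>t < i \<le> 2t\<close> take each of the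
  values \<open>0,\<dots>,2t\<close> exactly once in every coordinate, giving \<open>2t+1\<close> dots. For \<open>n = 3t+2\<close> increase
  every \<open>r\<close> by one; for \<open>n = 3t\<close> drop the dot with \<open>r = 0\<close> (\<open>i = t+1\<close>) and decrease every \<open>r\<close>
  by one.
\<close>

lemma floor_two_thirds: "\<lfloor>(2 * real n + 1) / 3\<rfloor> = int ((2 * n + 1) div 3)"
  using floor_divide_of_nat_eq[where ?'a = real, of "2 * n + 1" 3] by (simp add: add.commute)

text \<open>In each residue class modulo 3 the fractional summand, if there is one, lies in [0,1),
  so only the integer part survives.\<close>

lemma floor_LP_star: "\<lfloor>LP_star n\<rfloor> = int ((2 * n + 1) div 3)"
proof -
  define t where "t = n div 3"
  have "n = 3 * t \<or> n = 3 * t + 1 \<or> n = 3 * t + 2"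
    unfolding t_def by presburger
  then consider "n = 3 * t" "(2 * n + 1) div 3 = 2 * t"
    | "n = 3 * t + 1" "(2 * n + 1) div 3 = 2 * t + 1"
    | "n = 3 * t + 2" "(2 * n + 1) div 3 = 2 * t + 1"
    by fastforce
  then show ?thesis
  proof cases
    case 1
    have "real t / (3 * real t + 1) < 1" "real t / (3 * real t + 1) \<ge> 0" by simp_all
    then show ?thesis
      unfolding 1(2) unfolding 1(1) LP_star_simps by (intro floor_unique) simp_all
  next
    case 2
    show ?thesis
      unfolding 2(2) unfolding 2(1) LP_star_simps by (intro floor_unique) simp_all
  next
    case 3
    have "(2 * real t + 1) / (3 * real t + 2) < 1" "(2 * real t + 1) / (3 * real t + 2) \<ge> 0"
      by simp_all
    then show ?thesis
      unfolding 3(2) unfolding 3(1) LP_star_simps by (intro floor_unique) simp_all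
  qed
qed

text \<open>The coordinate q of the dot with p = i.\<close>

definition offset :: "nat \<Rightarrow> nat \<Rightarrow> nat" where
  "offset t i = (if i \<le> t then 2 * t - 2 * i else 4 * t + 1 - 2 * i)"

text \<open>Trades truncated subtraction for a linear equation; i \<le> 2t keeps both branches from
  being cut off at 0.\<close>

lemma offset_add:
  "i \<le> 2 * t \<Longrightarrow> offset t i + 2 * i = (if i \<le> t then 2 * t else 4 * t + 1)"
  by (simp add: offset_def)

text \<open>Parity separates the branches: values are even for i \<le> t and odd beyond. Within a
  branch the value determines i.\<close>

lemma inj_on_offset: "inj_on (offset t) {..2 * t}"
proof (rule inj_onI)
  fix i j assume "i \<in> {..2 * t}" "j \<in> {..2 * t}" and eq: "offset t i = offset t j"
  then have i: "offset t i + 2 * i = (if i \<le> t then 2 * t else 4 * t + 1)"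
    and j: "offset t i + 2 * j = (if j \<le> t then 2 * t else 4 * t + 1)"
    using offset_add[of i t] offset_add[of j t] by simp_all
  have "even (offset t i) \<longleftrightarrow> i \<le> t" "even (offset t i) \<longleftrightarrow> j \<le> t"
    using arg_cong[OF i, of even] arg_cong[OF j, of even] by (simp_all split: if_splits)
  with i j have "2 * i = 2 * j" by (metis add_left_cancel)
  then show "i = j" by simp
qed

text \<open>The sum is 2t - i \<le> 2t on the first branch and 4t + 1 - i > 2t on the second, so the
  branches cannot collide.\<close>

lemma inj_on_add_offset: "inj_on (\<lambda>i. i + offset t i) {..2 * t}"
proof (rule inj_onI)
  fix i j assume "i \<in> {..2 * t}" "j \<in> {..2 * t}" and eq: "i + offset t i = j + offset t j"
  then have ij: "i \<le> 2 * t" "j \<le> 2 * t" by simp_all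
  from eq offset_add[OF ij(1)] offset_add[OF ij(2)] ij show "i = j"
    by (cases "i \<le> t"; cases "j \<le> t"; simp only: if_True if_False; linarith)
qed

lemma inj_on_diff_left:
  fixes f :: "'a \<Rightarrow> nat"
  assumes "inj_on f A" "\<And>x. x \<in> A \<Longrightarrow> f x \<le> n"
  shows "inj_on (\<lambda>x. n - f x) A"
proof (rule inj_onI)
  fix x y assume xy: "x \<in> A" "y \<in> A" "n - f x = n - f y"
  then have "f x = f y" using assms(2)[of x] assms(2)[of y] by linarith
  then show "x = y" using xy assms(1) by (simp add: inj_on_eq_iff)
qed

lemma finite_triangle [simp]: "finite (triangle n)"
  by (rule finite_subset[of _ "{1..n} \<times> {1..n}"]) (auto simp: triangle_def)

text \<open>Every line is a fibre of one of these three maps on the triangle.\<close>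

lemma dot_placementI:
  assumes "D \<subseteq> triangle n" "inj_on fst D" "inj_on snd D" "inj_on (\<lambda>(a, b). a + b) D"
  shows "dot_placement n D"
  unfolding dot_placement_def
proof (intro conjI ballI assms)
  fix L assume L: "L \<in> lines n"
  have "finite (D \<inter> L)"
    using assms(1) finite_subset[OF _ finite_triangle] by blast
  moreover have "C = C'" if "C \<in> D \<inter> L" "C' \<in> D \<inter> L" for C C'
  proof -
    from L that have "fst C = fst C' \<or> snd C = snd C' \<or> (\<lambda>(a, b). a + b) C = (\<lambda>(a, b). a + b) C'"
      by (auto simp: lines_def row_def column_def diagonal_def)
    then show ?thesis
      using that assms(2-4)[THEN inj_onD] by blast
  qed
  ultimately show "card (D \<inter> L) \<le> 1"
    by (simp add: card_le_Suc0_iff_eq)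
qed

lemma finite_dot_placement_cards: "finite {card D |D. dot_placement n D}"
  by (rule finite_subset[of _ "card ` Pow (triangle n)"]) (auto simp: dot_placement_def)

lemma card_le_max_dots: "dot_placement n D \<Longrightarrow> card D \<le> max_dots n"
  unfolding max_dots_def using finite_dot_placement_cards by (intro Max_ge) auto

text \<open>The second assumption says r \<ge> 0. Only r depends on n, so one construction serves
  all residues, with I selecting the dots kept.\<close>

lemma card_le_max_dots_offset:
  assumes I: "I \<subseteq> {..2 * t}" and less: "\<And>i. i \<in> I \<Longrightarrow> i + offset t i < n"
  shows "card I \<le> max_dots n"
proof -
  let ?f = "\<lambda>i. (n - i, n - offset t i)"
  have le: "i \<le> n" "offset t i \<le> n" "i + offset t i \<le> 2 * n" if "i \<in> I" for i
    using less[OF that] by linarith+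
  have "inj_on (\<lambda>i. n - i) I"
    using inj_on_diff_left[OF inj_on_id2] le(1) by blast
  then have fst: "inj_on (fst \<circ> ?f) I" by (simp add: comp_def)
  have "inj_on (\<lambda>i. n - offset t i) I"
    using inj_on_diff_left[OF inj_on_subset[OF inj_on_offset I]] le(2) by blast
  then have snd: "inj_on (snd \<circ> ?f) I" by (simp add: comp_def)
  have "inj_on (\<lambda>i. 2 * n - (i + offset t i)) I"
    using inj_on_diff_left[OF inj_on_subset[OF inj_on_add_offset I]] le(3) by blast
  moreover have "2 * n - (i + offset t i) = (n - i) + (n - offset t i)" if "i \<in> I" for i
    using le[OF that] by linarith
  ultimately have "inj_on ((\<lambda>(a, b). a + b) \<circ> ?f) I"
    by (simp add: comp_def cong: inj_on_cong)
  moreover have "?f i \<in> triangle n" if "i \<in> I" for i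
  proof -
    have "n - i \<ge> 1" "n - offset t i \<ge> 1" "(n - i) + (n - offset t i) \<ge> n + 1"
      using less[OF that] by linarith+
    then show ?thesis by (simp add: triangle_def)
  qed
  ultimately have "dot_placement n (?f ` I)"
    using fst snd by (intro dot_placementI inj_on_imageI image_subsetI)
  then have "card (?f ` I) \<le> max_dots n" by (rule card_le_max_dots)
  then show ?thesis by (simp add: card_image[OF inj_on_imageI2[OF fst]])
qed

lemma max_dots_ge:
  assumes "n \<ge> 1"
  shows "(2 * n + 1) div 3 \<le> max_dots n"
proof -
  define t where "t = n div 3"
  have add: "offset t i + 2 * i = (if i \<le> t then 2 * t else 4 * t + 1)" if "i \<le> 2 * t" for i
    using that by (rule offset_add)
  consider "n = 3 * t" | "3 * t < n" "n \<le> 3 * t + 2"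
    unfolding t_def by linarith
  then show ?thesis
  proof cases
    case 1
    with assms have "t \<ge> 1" by simp
    \<comment> \<open>On {0,...,2t} the sum is at most 3t = n, with equality only at i = t + 1. As t
      \<ge> 1, this index lies in the range, and 2t dots remain.\<close>
    have "i + offset t i < n" if "i \<in> {..2 * t} - {t + 1}" for i
      using that add[of i] 1 \<open>t \<ge> 1\<close> by (cases "i \<le> t") auto
    then have "card ({..2 * t} - {t + 1}) \<le> max_dots n"
      by (intro card_le_max_dots_offset) blast
    with \<open>t \<ge> 1\<close> 1 show ?thesis by simp
  next
    case 2
    \<comment> \<open>The sum never exceeds 3t, so all 2t + 1 dots fit.\<close>
    have "i + offset t i < n" if "i \<in> {..2 * t}" for i
      using that add[of i] 2(1) by (cases "i \<le> t") auto
    then have "card {..2 * t} \<le> max_dots n"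
      by (intro card_le_max_dots_offset) blast
    moreover have "(2 * n + 1) div 3 \<le> 2 * t + 1"
      using 2(2) by linarith
    ultimately show ?thesis by simp
  qed
qed

lemma lines_subset_triangle: "L \<in> lines n \<Longrightarrow> L \<subseteq> triangle n"
  by (auto simp: lines_def row_def column_def diagonal_def)

text \<open>Adds up the n row constraints. The crude bound serves only to make the supremum in
  \<open>LP\<close> an upper bound.\<close>

lemma LP_feasible_sum_le:
  assumes "LP_feasible n x"
  shows "(\<Sum>C\<in>triangle n. x C) \<le> real n"
proof -
  have "(\<Sum>C\<in>triangle n. x C) = (\<Sum>i\<in>{1..n}. \<Sum>C | C \<in> triangle n \<and> fst C = i. x C)"
    by (rule sum.group[symmetric, OF finite_triangle]) (auto simp: triangle_def)
  also have "\<dots> \<le> (\<Sum>i\<in>{1..n}. 1)"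
  proof (rule sum_mono)
    fix i assume "i \<in> {1..n}"
    moreover have "{C. C \<in> triangle n \<and> fst C = i} = row n i"
      by (auto simp: row_def)
    ultimately show "(\<Sum>C | C \<in> triangle n \<and> fst C = i. x C) \<le> 1"
      using assms by (auto simp: LP_feasible_def lines_def)
  qed
  finally show ?thesis by simp
qed

lemma LP_feasible_le_LP:
  assumes "LP_feasible n x"
  shows "(\<Sum>C\<in>triangle n. x C) \<le> LP n"
  unfolding LP_def
proof (rule cSup_upper)
  show "bdd_above {\<Sum>C\<in>triangle n. x C |x. LP_feasible n x}"
    using LP_feasible_sum_le by (intro bdd_aboveI[of _ "real n"]) blast
qed (use assms in blast)

lemma dot_placement_card_le_LP:
  assumes "dot_placement n D"
  shows "real (card D) \<le> LP n"
proof -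
  have D: "D \<subseteq> triangle n" and le: "\<And>L. L \<in> lines n \<Longrightarrow> card (D \<inter> L) \<le> 1"
    using assms by (auto simp: dot_placement_def)
  \<comment> \<open>Applied to lines for feasibility and to the whole triangle for the
    objective.\<close>
  have sum: "(\<Sum>C\<in>L. of_bool (C \<in> D)) = real (card (D \<inter> L))" if "L \<subseteq> triangle n" for L
    using finite_subset[OF that] by (simp add: Int_commute)
  have "LP_feasible n (\<lambda>C. of_bool (C \<in> D))"
    using le lines_subset_triangle by (auto simp: LP_feasible_def sum simp del: sum_of_bool_eq)
  from LP_feasible_le_LP[OF this] D show ?thesis
    by (simp add: sum Int_absorb2 del: sum_of_bool_eq)
qed

lemma max_dots_le_LP: "real (max_dots n) \<le> LP n"
proof -
  \<comment> \<open>The empty placement makes the set nonempty, so that its maximum is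
    attained.\<close>
  have "dot_placement n {}" by (simp add: dot_placement_def)
  then have "max_dots n \<in> {card D |D. dot_placement n D}"
    unfolding max_dots_def using finite_dot_placement_cards by (intro Max_in) auto
  then show ?thesis using dot_placement_card_le_LP by auto
qed

theorem theorem3:
  assumes "\<forall>n\<ge>1. LP n = LP_star n"
  shows "\<forall>n\<ge>1. int (max_dots n) = \<lfloor>(2 * real n + 1) / 3\<rfloor>"
proof (intro allI impI)
  fix n :: nat assume n: "n \<ge> 1"
  then have "LP n = LP_star n" using assms by blast
  then have "of_int (int (max_dots n)) \<le> LP_star n"
    using max_dots_le_LP[of n] by simp
  \<comment> \<open>An integer below a real number is below its floor.\<close>
  then have "int (max_dots n) \<le> int ((2 * n + 1) div 3)"
    unfolding floor_LP_star[symmetric] by (simp only: le_floor_iff)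
  with max_dots_ge[OF n] show "int (max_dots n) = \<lfloor>(2 * real n + 1) / 3\<rfloor>"
    unfolding floor_two_thirds by simp
qed

end
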